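(* Let $(C,\underline{0},x)$ be an $s$-elusive triple in $H(m,q)$ with $\delta\geq 2s+1$, where $\delta$ is the minimum distance of $C$. Then the set $\varGamma_{2s}(\underline{0})\cap C^x$ forms a $q$-ary $s$-$(m,2s,1)$ design. In particular, if $q=2$, then $\varGamma_{2s}(\underline{0})\cap C^x$ forms an $S(s,2s,m)$ Steiner system.
   Context: The Hamming graph $\varGamma=H(m,q)$ has as vertices all $m$-tuples with entries from a set $Q$ of size $q$ containing a distinguished element $0$; two vertices are adjacent iff they differ in exactly one entry. $d(\alpha,\beta)$ is the Hamming distance; $\underline{0}$ is the all-zero vertex; $\varGamma_r(\alpha)=\{\beta\mid d(\alpha,\beta)=r\}$ (so $\varGamma_r(\underline 0)$ is the set of vertices of weight $r$). A code $C$ is a subset of the vertex set; its minimum distance is $\delta=\min\{d(\alpha,\beta)\mid\alpha,\beta\in C,\ \alpha\neq\beta\}$. For a vertex $\alpha$, $d(\alpha,C)=\min\{d(\alpha,\beta)\mid\beta\in C\}$; the covering radius $\rho$ of $C$ is the maximum of $d(\alpha,C)$ over all vertices; for $r\in\{0,\ldots,\rho\}$ the set of $r$-neighbours of $C$ is $C_r=\{\alpha\mid d(\alpha,C)=r\}$. For a set $S$ of vertices, $\mathrm{Aut}(S)$ is the setwise stabiliser of $S$ in the full automorphism group $\mathrm{Aut}(\varGamma)$ of the graph; $\alpha^x$ and $C^x$ are the images of a vertex $\alpha$ and of a code $C$ under $x\in\mathrm{Aut}(\varGamma)$. Codes $C,C'$ are equivalent if $C'=C^x$ for some $x\in\mathrm{Aut}(\varGamma)$.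 For $s\in\{0,\ldots,\rho\}$, $C$ is $s$-elusive if there exists a code $C'\neq C$ equivalent to $C$ such that $C$ and $C'$ have the same set of $s$-neighbours; equivalently, if $\mathrm{Aut}(C_s)$ is strictly larger than $\mathrm{Aut}(C)$. An $s$-elusive triple in $H(m,q)$ is a triple $(C,\alpha,x)$ where $C$ is an $s$-elusive code in $H(m,q)$, $x\in\mathrm{Aut}(C_s)\setminus\mathrm{Aut}(C)$, and $\alpha\in C$ is such that $\alpha^x\notin C$. A vertex $\nu$ is covered by a vertex $\alpha$ if $\nu_i=\alpha_i$ for every entry $i$ with $\nu_i\neq 0$. A $q$-ary $t$-$(m,k,\lambda)$ design is a subset $\mathcal{D}\subseteq\varGamma_k(\underline{0})$ such that each vertex $\nu\in\varGamma_t(\underline{0})$ is covered by exactly $\lambda$ vertices of $\mathcal{D}$. When $q=2$ this is simply called a $t$-$(m,k,\lambda)$ design, and when $q=2$ and $\lambda=1$ it is called an $S(t,k,m)$ Steiner system.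
   Formalization: The claim as printed fails when the zero vertex lies in C^x (the set is then empty); what is proved is the design and Steiner claim for the image of C under the inverse of x, and for C^x itself whenever the zero vertex is not in C^x. *)

theory Defs
  imports "HOL-Analysis.Finite_Cartesian_Product" "HOL-Library.Extended_Nat"
begin

text \<open>
  The vertices of \<open>H(m, q)\<close> are the elements of \<open>'q ^ 'm\<close>, where \<open>m = CARD('m)\<close> and
  \<open>q = CARD('q)\<close>. The class \<open>zero\<close> carries no axioms: it only provides the distinguished
  element of the alphabet, and \<open>0 :: 'q ^ 'm\<close> is then the all-zero vertex.
  An automorphism \<open>x\<close> acts by application: \<open>x a\<close> is the image of the vertex \<open>a\<close>, \<open>x ` C\<close> that
  of the code \<open>C\<close>, and \<open>inv x ` C\<close> is the image of \<open>C\<close> under the inverse of \<open>x\<close>.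
\<close>

definition hamming_adj :: "'q ^ 'm \<Rightarrow> 'q ^ 'm \<Rightarrow> bool" where
  "hamming_adj a b \<longleftrightarrow> (\<exists>!i. a $ i \<noteq> b $ i)"

definition hamming_dist :: "'q ^ 'm \<Rightarrow> 'q ^ 'm \<Rightarrow> nat" where
  "hamming_dist a b = card {i. a $ i \<noteq> b $ i}"

definition sphere_at :: "nat \<Rightarrow> 'q ^ 'm \<Rightarrow> ('q ^ 'm) set" where
  "sphere_at r a = {b. hamming_dist a b = r}"

text \<open>Codes with at most one codeword have minimum distance \<open>\<infinity>\<close> (the infimum of the empty set).\<close>

definition min_dist :: "('q ^ 'm) set \<Rightarrow> enat" where
  "min_dist C = Inf {enat (hamming_dist a b) | a b. a \<in> C \<and> b \<in> C \<and> a \<noteq> b}"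

text \<open>The following three notions are meaningful for nonempty codes over a finite alphabet.\<close>

definition dist_to_code :: "'q ^ 'm \<Rightarrow> ('q ^ 'm) set \<Rightarrow> nat" where
  "dist_to_code a C = Min (hamming_dist a ` C)"

definition covering_radius :: "('q ^ 'm) set \<Rightarrow> nat" where
  "covering_radius C = Max (range (\<lambda>a. dist_to_code a C))"

definition code_nbrs :: "('q ^ 'm) set \<Rightarrow> nat \<Rightarrow> ('q ^ 'm) set" where
  "code_nbrs C r = {a. dist_to_code a C = r}"

definition hamming_aut :: "('q ^ 'm \<Rightarrow> 'q ^ 'm) set" where
  "hamming_aut = {x. bij x \<and> (\<forall>a b. hamming_adj (x a) (x b) \<longleftrightarrow> hamming_adj a b)}"

definition set_aut :: "('q ^ 'm) set \<Rightarrow> ('q ^ 'm \<Rightarrow> 'q ^ 'm) set" where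
  "set_aut S = {x \<in> hamming_aut. x ` S = S}"

definition code_equiv :: "('q ^ 'm) set \<Rightarrow> ('q ^ 'm) set \<Rightarrow> bool" where
  "code_equiv C C' \<longleftrightarrow> (\<exists>x \<in> hamming_aut. C' = x ` C)"

definition s_elusive :: "nat \<Rightarrow> ('q ^ 'm) set \<Rightarrow> bool" where
  "s_elusive s C \<longleftrightarrow> s \<le> covering_radius C \<and>
     (\<exists>C'. C' \<noteq> C \<and> code_equiv C C' \<and> code_nbrs C s = code_nbrs C' s)"

definition elusive_triple ::
    "nat \<Rightarrow> ('q ^ 'm) set \<Rightarrow> 'q ^ 'm \<Rightarrow> ('q ^ 'm \<Rightarrow> 'q ^ 'm) \<Rightarrow> bool" where
  "elusive_triple s C a x \<longleftrightarrow> s_elusive s C \<and>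
     x \<in> set_aut (code_nbrs C s) - set_aut C \<and> a \<in> C \<and> x a \<notin> C"

definition covered_by :: "'q::zero ^ 'm \<Rightarrow> 'q ^ 'm \<Rightarrow> bool" where
  "covered_by v a \<longleftrightarrow> (\<forall>i. v $ i \<noteq> 0 \<longrightarrow> v $ i = a $ i)"

text \<open>
  \<open>q_ary_design t k l D\<close>: \<open>D\<close> is a \<open>q\<close>-ary \<open>t\<close>-\<open>(m, k, l)\<close> design, and
  \<open>steiner_system t k D\<close>: \<open>D\<close> is an \<open>S(t, k, m)\<close> Steiner system;
  \<open>m\<close> and \<open>q\<close> are read off the type of \<open>D\<close>.
\<close>

definition q_ary_design :: "nat \<Rightarrow> nat \<Rightarrow> nat \<Rightarrow> ('q::zero ^ 'm) set \<Rightarrow> bool" where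
  "q_ary_design t k l D \<longleftrightarrow> D \<subseteq> sphere_at k 0 \<and>
     (\<forall>v \<in> sphere_at t 0. card {a \<in> D. covered_by v a} = l)"

definition steiner_system :: "nat \<Rightarrow> nat \<Rightarrow> ('q::zero ^ 'm) set \<Rightarrow> bool" where
  "steiner_system t k D \<longleftrightarrow> CARD('q) = 2 \<and> q_ary_design t k 1 D"

end

theory Submission
  imports Defs
begin

text \<open>
  Only four properties of the image code \<open>D\<close> (of \<open>C\<close> under \<open>x\<close> or its inverse) matter: it is
  nonempty and avoids \<open>0\<close>, it has the same \<open>s\<close>-neighbours as \<open>C\<close>, and its codewords are at
  least \<open>2s + 1\<close> apart. The last two hold because an automorphism of the Hamming graph is an
  isometry (\<open>automorphism_isometry\<close>) and \<open>x\<close> fixes the set of \<open>s\<close>-neighbours of \<open>C\<close>.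

  Since \<open>0 \<in> C\<close> and the distance between codewords exceeds \<open>2s\<close>, every vertex of weight \<open>s\<close> has
  \<open>0\<close> as its nearest codeword, so it is an \<open>s\<close>-neighbour of \<open>C\<close> and hence of \<open>D\<close>. A word
  \<open>c \<in> D\<close> therefore cannot have weight strictly between \<open>0\<close> and \<open>2s\<close>: otherwise some vertex
  of weight \<open>s\<close>, obtained by shrinking or enlarging the support of \<open>c\<close>, would be closer than
  \<open>s\<close> to \<open>c\<close> (\<open>close_vertex_of_given_weight\<close>). Consequently, if \<open>v\<close> has weight \<open>s\<close>,
  then a word of \<open>D\<close> at distance \<open>s\<close> from \<open>v\<close> has weight exactly \<open>2s\<close>, so that \<open>v\<close> lies on a
  geodesic from \<open>0\<close> to that word; this means that the word covers \<open>v\<close>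
  (\<open>covered_by_iff_dist\<close>). Two such words would be at distance at most \<open>2s\<close>, so there is only
  one (\<open>design_of_shared_nbrs\<close>).
\<close>

section \<open>Hamming distance and covering\<close>

lemma hamming_dist_self [simp]: "hamming_dist a a = 0"
  by (simp add: hamming_dist_def)

lemma hamming_dist_eq_0_iff: "hamming_dist a b = 0 \<longleftrightarrow> a = b"
  for a b :: "'q ^ 'm::finite"
  by (simp add: hamming_dist_def vec_eq_iff)

lemma hamming_dist_commute: "hamming_dist a b = hamming_dist b a"
  by (simp add: hamming_dist_def eq_commute)

lemma hamming_dist_triangle: "hamming_dist a c \<le> hamming_dist a b + hamming_dist b c"
  for a b c :: "'q ^ 'm::finite"
proof -
  have "{i. a $ i \<noteq> c $ i} \<subseteq> {i. a $ i \<noteq> b $ i} \<union> {i. b $ i \<noteq> c $ i}"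
    by auto
  then have "card {i. a $ i \<noteq> c $ i} \<le> card ({i. a $ i \<noteq> b $ i} \<union> {i. b $ i \<noteq> c $ i})"
    by (intro card_mono) auto
  also have "\<dots> \<le> card {i. a $ i \<noteq> b $ i} + card {i. b $ i \<noteq> c $ i}"
    by (rule card_Un_le)
  finally show ?thesis
    by (simp add: hamming_dist_def)
qed

lemma hamming_adj_iff_dist: "hamming_adj a b \<longleftrightarrow> hamming_dist a b = 1"
  for a b :: "'a ^ 'b"
proof -
  have "(\<exists>!i. P i) \<longleftrightarrow> (\<exists>i. {j. P j} = {i})" for P :: "'b \<Rightarrow> bool"
    by (auto simp: set_eq_iff)
  then show ?thesis
    by (simp add: hamming_adj_def hamming_dist_def card_1_singleton_iff)
qed

text \<open>
  A vertex covered by \<open>a\<close> is one that lies on a geodesic from \<open>0\<close> to \<open>a\<close>: the support of \<open>a\<close> is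
  contained in the union of the support of \<open>v\<close> and the set where \<open>v\<close> and \<open>a\<close> differ, and \<open>a\<close>
  covers \<open>v\<close> iff these two sets are disjoint. In that case their union is the whole support
  of \<open>a\<close>.
\<close>

lemma covered_by_iff_dist:
  fixes v a :: "'q::zero ^ 'm::finite"
  shows "covered_by v a \<longleftrightarrow> hamming_dist 0 v + hamming_dist v a = hamming_dist 0 a"
proof -
  let ?V = "{i. (0::'q ^ 'm) $ i \<noteq> v $ i}" and ?A = "{i. (0::'q ^ 'm) $ i \<noteq> a $ i}"
    and ?E = "{i. v $ i \<noteq> a $ i}"
  show ?thesis
  proof
    assume "covered_by v a"
    then have "?A = ?V \<union> ?E" "?V \<inter> ?E = {}"
      by (auto simp: covered_by_def)
    then show "hamming_dist 0 v + hamming_dist v a = hamming_dist 0 a"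
      by (simp add: hamming_dist_def card_Un_disjoint)
  next
    assume geodesic: "hamming_dist 0 v + hamming_dist v a = hamming_dist 0 a"
    have "?A \<subseteq> ?V \<union> ?E"
      by auto
    then have "card ?A \<le> card (?V \<union> ?E)"
      by (intro card_mono) auto
    moreover have "card ?V + card ?E = card (?V \<union> ?E) + card (?V \<inter> ?E)"
      by (intro card_Un_Int) auto
    moreover have "card ?V + card ?E = card ?A"
      using geodesic by (simp only: hamming_dist_def)
    ultimately have "card (?V \<inter> ?E) = 0"
      by linarith
    then have "?V \<inter> ?E = {}"
      by (simp only: card_0_eq finite_class.finite)
    then show "covered_by v a"
      by (auto simp: covered_by_def)
  qed
qed

section \<open>Automorphisms of the Hamming graph are isometries\<close>

text \<open>
  Changing the entries in which \<open>a\<close> and \<open>b\<close> differ one at a time gives a path from \<open>a\<close> to \<open>b\<close>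
  of length \<open>hamming_dist a b\<close>, and a graph homomorphism maps it to a path of the same length.
\<close>

lemma adj_preserving_nonexpansive:
  fixes f :: "'q ^ 'm::finite \<Rightarrow> 'q ^ 'm"
  assumes adj: "\<And>a b. hamming_adj a b \<Longrightarrow> hamming_adj (f a) (f b)"
  shows "hamming_dist (f a) (f b) \<le> hamming_dist a b"
proof (induction "hamming_dist a b" arbitrary: a)
  case 0
  then have "a = b"
    by (metis hamming_dist_eq_0_iff)
  then show ?case
    by simp
next
  case (Suc n)
  then have "a \<noteq> b"
    by auto
  then obtain i where i: "a $ i \<noteq> b $ i"
    by (auto simp: vec_eq_iff)
  define c where "c = (\<chi> j. if j = i then b $ i else a $ j)"
  have "hamming_adj a c"
    using i by (auto simp: hamming_adj_def c_def)
  then have ac: "hamming_dist (f a) (f c) = 1"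
    using adj by (simp add: hamming_adj_iff_dist)
  have "{j. c $ j \<noteq> b $ j} = {j. a $ j \<noteq> b $ j} - {i}"
    by (auto simp: c_def)
  then have "hamming_dist c b = n"
    using Suc.hyps(2) i by (simp add: hamming_dist_def)
  with Suc.hyps(1) have "hamming_dist (f c) (f b) \<le> n"
    by blast
  then show ?case
    using ac Suc.hyps(2) hamming_dist_triangle[of "f a" "f b" "f c"] by simp
qed

lemma inv_in_hamming_aut:
  assumes "x \<in> hamming_aut"
  shows "inv x \<in> hamming_aut"
proof -
  have "bij x" and adj: "hamming_adj (x a) (x b) \<longleftrightarrow> hamming_adj a b" for a b
    using assms by (auto simp: hamming_aut_def)
  then have "hamming_adj (inv x a) (inv x b) \<longleftrightarrow> hamming_adj a b" for a b
    using adj[of "inv x a" "inv x b"] by (simp add: bij_is_surj surj_f_inv_f)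
  then show ?thesis
    using \<open>bij x\<close> by (simp add: hamming_aut_def bij_imp_bij_inv)
qed

lemma automorphism_isometry:
  fixes x :: "'q ^ 'm::finite \<Rightarrow> 'q ^ 'm"
  assumes "x \<in> hamming_aut"
  shows "hamming_dist (x a) (x b) = hamming_dist a b"
proof (rule antisym)
  show "hamming_dist (x a) (x b) \<le> hamming_dist a b"
    using assms by (intro adj_preserving_nonexpansive) (simp add: hamming_aut_def)
  have "hamming_dist (inv x (x a)) (inv x (x b)) \<le> hamming_dist (x a) (x b)"
    using inv_in_hamming_aut[OF assms]
    by (intro adj_preserving_nonexpansive) (simp add: hamming_aut_def)
  then show "hamming_dist a b \<le> hamming_dist (x a) (x b)"
    using assms by (simp add: hamming_aut_def bij_is_inj)
qed

lemma code_nbrs_image: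
  fixes C :: "('q ^ 'm::finite) set"
  assumes x: "x \<in> hamming_aut"
  shows "code_nbrs (x ` C) r = x ` code_nbrs C r"
proof -
  have "dist_to_code (x a) (x ` C) = dist_to_code a C" for a
    by (simp add: dist_to_code_def image_image automorphism_isometry[OF x])
  then have nbrs: "x a \<in> code_nbrs (x ` C) r \<longleftrightarrow> a \<in> code_nbrs C r" for a
    by (simp add: code_nbrs_def)
  have "surj x"
    using x by (simp add: hamming_aut_def bij_is_surj)
  show ?thesis
  proof (intro set_eqI iffI)
    fix b
    assume b: "b \<in> code_nbrs (x ` C) r"
    obtain a where "b = x a"
      using \<open>surj x\<close> by (rule surjE)
    then show "b \<in> x ` code_nbrs C r"
      using b nbrs by simp
  qed (use nbrs in auto)
qed

lemma le_min_dist_iff: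
  "enat n \<le> min_dist C \<longleftrightarrow> (\<forall>a\<in>C. \<forall>b\<in>C. a \<noteq> b \<longrightarrow> n \<le> hamming_dist a b)"
proof -
  have "enat n \<le> min_dist C \<longleftrightarrow>
      (\<forall>e \<in> {enat (hamming_dist a b) | a b. a \<in> C \<and> b \<in> C \<and> a \<noteq> b}. enat n \<le> e)"
    by (simp only: min_dist_def le_Inf_iff)
  also have "\<dots> \<longleftrightarrow>
      (\<forall>a\<in>C. \<forall>b\<in>C. a \<noteq> b \<longrightarrow> enat n \<le> enat (hamming_dist a b))"
    by blast
  finally show ?thesis
    by (simp only: enat_ord_simps)
qed

lemma le_min_dist_image:
  fixes C :: "('q ^ 'm::finite) set"
  assumes "x \<in> hamming_aut" "enat n \<le> min_dist C"
  shows "enat n \<le> min_dist (x ` C)"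
  using assms by (auto simp: le_min_dist_iff automorphism_isometry)

lemma inv_in_set_aut:
  assumes "x \<in> set_aut S"
  shows "inv x \<in> set_aut S"
proof -
  have "x \<in> hamming_aut" "x ` S = S"
    using assms by (auto simp: set_aut_def)
  moreover from this have "inv x ` S = S"
    using image_inv_f_f[of x S] by (simp add: hamming_aut_def bij_is_inj)
  ultimately show ?thesis
    by (simp add: set_aut_def inv_in_hamming_aut)
qed

section \<open>Codes with the same neighbours\<close>

lemma mem_code_nbrs_iff:
  fixes C :: "('q::finite ^ 'm::finite) set"
  assumes "C \<noteq> {}"
  shows "a \<in> code_nbrs C r \<longleftrightarrow> (\<exists>c\<in>C. hamming_dist a c = r) \<and> (\<forall>c\<in>C. r \<le> hamming_dist a c)"
proof -
  have "finite (hamming_dist a ` C)"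
    by simp
  then show ?thesis
    using assms by (auto simp: code_nbrs_def dist_to_code_def Min_eq_iff image_iff)
qed

text \<open>
  This vertex will be too close to \<open>c\<close> for \<open>c\<close> to lie in a code whose \<open>s\<close>-neighbours include
  all vertices of weight \<open>s\<close>. To find it, take a set of entries of the desired size that is
  contained in the support of \<open>c\<close> or contains it: setting \<open>c\<close> to \<open>0\<close> outside this set and
  filling its zeros inside the set costs only the difference of the two weights. The
  vertex \<open>v\<close> is there to witness that its weight is at most the number of entries.
\<close>

lemma close_vertex_of_given_weight:
  fixes c v :: "'q::zero ^ 'm::finite"
  assumes c: "0 < hamming_dist 0 c" "hamming_dist 0 c < 2 * hamming_dist 0 v"
  obtains u where "hamming_dist 0 u = hamming_dist 0 v" "hamming_dist u c < hamming_dist 0 v"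
proof -
  let ?supp = "{i. 0 \<noteq> c $ i}"
  define s where "s = hamming_dist 0 v"
  define w where "w = hamming_dist 0 c"
  have w: "card ?supp = w"
    by (simp add: w_def hamming_dist_def)
  have "s \<le> CARD('m)"
    unfolding s_def hamming_dist_def by (intro card_mono) auto
  then obtain S where S: "card S = s" "S \<subseteq> ?supp \<or> ?supp \<subseteq> S"
  proof (cases "s \<le> w")
    case True
    then show ?thesis
      using w that by (metis obtain_subset_with_card_n)
  next
    case False
    then have "\<exists>S. ?supp \<subseteq> S \<and> S \<subseteq> UNIV \<and> card S = s"
      using w \<open>s \<le> CARD('m)\<close> by (intro exists_subset_between) auto
    then show ?thesis
      using that by blast
  qed
  have "c \<noteq> 0"
    using c(1) by auto
  then obtain e :: 'q where e: "e \<noteq> 0"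
    by (auto simp: vec_eq_iff)
  define u where "u = (\<chi> i. if i \<in> S then if c $ i = 0 then e else c $ i else 0)"
  have "{i. 0 \<noteq> u $ i} = S"
    using e by (auto simp: u_def)
  then have "hamming_dist 0 u = s"
    using S by (simp add: hamming_dist_def)
  moreover have "hamming_dist u c < s"
    using S(2)
  proof
    assume "S \<subseteq> ?supp"
    moreover from this have "{i. u $ i \<noteq> c $ i} = ?supp - S"
      using e by (auto simp: u_def)
    ultimately have "hamming_dist u c = w - s"
      using w S(1) by (simp add: hamming_dist_def card_Diff_subset)
    then show ?thesis
      using c by (simp add: w_def s_def)
  next
    assume "?supp \<subseteq> S"
    moreover from this have "{i. u $ i \<noteq> c $ i} = S - ?supp"
      using e by (auto simp: u_def)
    ultimately have "hamming_dist u c = s - w"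
      using w S(1) by (simp add: hamming_dist_def card_Diff_subset)
    then show ?thesis
      using c by (simp add: w_def s_def)
  qed
  ultimately show thesis
    using that by (simp add: s_def)
qed

text \<open>
  The vertices of weight \<open>s\<close> link the two codes: they are \<open>s\<close>-neighbours of \<open>C\<close> because of the
  codeword \<open>0\<close>, hence of \<open>D\<close>, for which they need other codewords since \<open>0 \<notin> D\<close>. The
  degenerate case \<open>s = 0\<close> is excluded implicitly, as \<open>0 \<in> C\<close> would then put \<open>0\<close> into \<open>D\<close>.
\<close>

lemma design_of_shared_nbrs:
  fixes C D :: "('q::{finite,zero} ^ 'm::finite) set"
  assumes C: "0 \<in> C" "enat (2 * s + 1) \<le> min_dist C"
    and D: "D \<noteq> {}" "0 \<notin> D" "enat (2 * s + 1) \<le> min_dist D"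
    and nbrs: "code_nbrs C s = code_nbrs D s"
  shows "q_ary_design s (2 * s) 1 (sphere_at (2 * s) 0 \<inter> D)"
  unfolding q_ary_design_def
proof (intro conjI ballI)
  show "sphere_at (2 * s) 0 \<inter> D \<subseteq> sphere_at (2 * s) 0"
    by blast
next
  have sphere: "v \<in> code_nbrs D s" if "hamming_dist 0 v = s" for v
  proof -
    have "s \<le> hamming_dist v c" if "c \<in> C" for c
    proof (cases "c = 0")
      case True
      then show ?thesis
        using \<open>hamming_dist 0 v = s\<close> by (simp add: hamming_dist_commute)
    next
      case False
      then have "2 * s + 1 \<le> hamming_dist 0 c"
        using C that by (simp add: le_min_dist_iff)
      then show ?thesis
        using hamming_dist_triangle[of 0 c v] \<open>hamming_dist 0 v = s\<close> by simp
    qed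
    then have "v \<in> code_nbrs C s"
      using C(1) that by (subst mem_code_nbrs_iff) (auto simp: hamming_dist_commute)
    then show ?thesis
      using nbrs by simp
  qed
  fix v :: "'q ^ 'm"
  assume "v \<in> sphere_at s 0"
  then have v: "hamming_dist 0 v = s"
    by (simp add: sphere_at_def)
  \<comment> \<open>A lighter word of \<open>D\<close> would be closer than \<open>s\<close> to some vertex of weight \<open>s\<close>.\<close>
  have heavy: "2 * s \<le> hamming_dist 0 c" if "c \<in> D" for c
  proof (rule ccontr)
    assume "\<not> 2 * s \<le> hamming_dist 0 c"
    moreover have "hamming_dist 0 c \<noteq> 0"
      using \<open>c \<in> D\<close> D(2) by (auto simp: hamming_dist_eq_0_iff)
    ultimately obtain u where "hamming_dist 0 u = s" "hamming_dist u c < s"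
      using close_vertex_of_given_weight[of c v] v by auto
    then show False
      using sphere[of u] that D(1) by (auto simp: mem_code_nbrs_iff)
  qed
  obtain c where c: "c \<in> D" "hamming_dist v c = s"
    using sphere[OF v] D(1) by (auto simp: mem_code_nbrs_iff)
  have "hamming_dist 0 c = 2 * s"
    using heavy[OF c(1)] hamming_dist_triangle[of 0 c v] v c(2) by simp
  then have mem: "c \<in> sphere_at (2 * s) 0 \<inter> D" "covered_by v c"
    using c v by (auto simp: sphere_at_def covered_by_iff_dist)
  have "a = c" if "a \<in> sphere_at (2 * s) 0 \<inter> D" "covered_by v a" for a
  proof (rule ccontr)
    assume "a \<noteq> c"
    then have "2 * s + 1 \<le> hamming_dist a c"
      using D(3) c(1) that by (simp add: le_min_dist_iff)
    moreover have "hamming_dist v a = s"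
      using that v by (simp add: sphere_at_def covered_by_iff_dist)
    ultimately show False
      using hamming_dist_triangle[of a c v] c(2) by (simp add: hamming_dist_commute)
  qed
  with mem have "{a \<in> sphere_at (2 * s) 0 \<inter> D. covered_by v a} = {c}"
    by blast
  then show "card {a \<in> sphere_at (2 * s) 0 \<inter> D. covered_by v a} = 1"
    by simp
qed

lemma design_of_image_code:
  fixes C :: "('q::{finite,zero} ^ 'm::finite) set"
  assumes C: "0 \<in> C" "enat (2 * s + 1) \<le> min_dist C"
    and y: "y \<in> set_aut (code_nbrs C s)" "0 \<notin> y ` C"
  shows "q_ary_design s (2 * s) 1 (sphere_at (2 * s) 0 \<inter> y ` C)"
proof -
  have aut: "y \<in> hamming_aut" and fixed: "y ` code_nbrs C s = code_nbrs C s"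
    using y(1) by (auto simp: set_aut_def)
  show ?thesis
  proof (rule design_of_shared_nbrs[OF C])
    show "code_nbrs C s = code_nbrs (y ` C) s"
      by (simp add: code_nbrs_image[OF aut] fixed)
    show "enat (2 * s + 1) \<le> min_dist (y ` C)"
      by (rule le_min_dist_image[OF aut C(2)])
  qed (use C y(2) in auto)
qed

theorem theorem5p6:
  fixes C :: "('q::{finite,zero} ^ 'm::finite) set"
    and x :: "'q ^ 'm \<Rightarrow> 'q ^ 'm"
    and s :: nat
  assumes "elusive_triple s C 0 x"
    and "min_dist C \<ge> enat (2 * s + 1)"
  shows "(q_ary_design s (2 * s) 1 (sphere_at (2 * s) 0 \<inter> inv x ` C) \<and>
          (CARD('q) = 2 \<longrightarrow> steiner_system s (2 * s) (sphere_at (2 * s) 0 \<inter> inv x ` C)))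
       \<and> (0 \<notin> x ` C \<longrightarrow>
          q_ary_design s (2 * s) 1 (sphere_at (2 * s) 0 \<inter> x ` C) \<and>
          (CARD('q) = 2 \<longrightarrow> steiner_system s (2 * s) (sphere_at (2 * s) 0 \<inter> x ` C)))"
proof -
  have C: "0 \<in> C" and x: "x \<in> set_aut (code_nbrs C s)" and "x 0 \<notin> C"
    using assms(1) by (auto simp: elusive_triple_def)
  have "bij x"
    using x by (simp add: set_aut_def hamming_aut_def)
  then have "0 \<notin> inv x ` C"
    using \<open>x 0 \<notin> C\<close> by (metis (no_types, lifting) bij_inv_eq_iff imageE)
  then have "q_ary_design s (2 * s) 1 (sphere_at (2 * s) 0 \<inter> inv x ` C)"
    by (rule design_of_image_code[OF C assms(2) inv_in_set_aut[OF x]])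
  moreover have "q_ary_design s (2 * s) 1 (sphere_at (2 * s) 0 \<inter> x ` C)" if "0 \<notin> x ` C"
    using that by (rule design_of_image_code[OF C assms(2) x])
  ultimately show ?thesis
    by (simp add: steiner_system_def)
qed

end
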